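(* Consider the multinomial logit model $\mathbf C^T\log(\mathbf L\boldsymbol\pi_i)=\boldsymbol\eta_i=\mathbf X_i\boldsymbol\theta$, $i=1,\dots,m$ (the unified form of the baseline-category, cumulative, adjacent-categories and continuation-ratio logit models with partial proportional odds), with true parameter value $\boldsymbol\theta_0\in\boldsymbol\Theta\subseteq\mathbb R^p$ and true order $\sigma_0\in\mathcal P$, and $N$ i.i.d. observations generated from it as described in the context. Let $(\hat{\boldsymbol\theta}_N,\hat\sigma_N)$ denote a maximum likelihood estimator, i.e. one that maximizes $l(\boldsymbol\theta,\sigma)$ over $\boldsymbol\theta\in\boldsymbol\Theta$, $\sigma\in\mathcal P$, and write $\mathrm{AIC}=\mathrm{AIC}(\hat{\boldsymbol\theta}_N,\hat\sigma_N)$ and $\mathrm{BIC}=\mathrm{BIC}(\hat{\boldsymbol\theta}_N,\hat\sigma_N)$. Then $$N^{-1}\left|\mathrm{AIC}-\mathrm{AIC}(\boldsymbol\theta_0,\sigma_0)\right|=N^{-1}\left|\mathrm{BIC}-\mathrm{BIC}(\boldsymbol\theta_0,\sigma_0)\right|\to0$$ almost surely, as $N\to\infty$.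
   Context: Model. There are $d\ge1$ covariates and $J\ge3$ response categories, and $\mathbf x_1,\dots,\mathbf x_m$ are distinct predetermined design points (level combinations of the covariates). In the unified form, $\boldsymbol\pi_i=(\pi_{i1},\dots,\pi_{iJ})^T$ are the positive category probabilities at $\mathbf x_i$ with $\sum_{j=1}^J\pi_{ij}=1$, $\log$ acts entrywise, $\mathbf C^T$ is a $J\times(2J-1)$ constant matrix and $\mathbf L$ is a $(2J-1)\times J$ constant matrix, both depending on the type of logit model, $\boldsymbol\eta_i=(\eta_{i1},\dots,\eta_{iJ})^T$ are the linear predictors, $\mathbf X_i$ is the model matrix consisting of $\mathbf h_j(\mathbf x_i)$ and $\mathbf h_c(\mathbf x_i)$, where $\mathbf h_j$ (with $p_j$ components, $j=1,\dots,J-1$) and $\mathbf h_c$ (with $p_c$ components) are known vector-valued predictor functions, and $\boldsymbol\theta=(\boldsymbol\beta_1^T,\dots,\boldsymbol\beta_{J-1}^T,\boldsymbol\zeta^T)^T$ consists of $p=p_1+\cdots+p_{J-1}+p_c$ regression parameters. This is a common way of writing the following four models (together with $\sum_{j=1}^J\pi_{ij}=1$), in which $\eta_{ij}=\mathbf h_j^T(\mathbf x_i)\boldsymbol\beta_j+\mathbf h_c^T(\mathbf x_i)\boldsymbol\zeta$ for $j=1,\dots,J-1$: - baseline-category: $\log(\pi_{ij}/\pi_{iJ})=\eta_{ij}$; - cumulative: $\log\big((\pi_{i1}+\cdots+\pi_{ij})/(\pi_{i,j+1}+\cdots+\pi_{iJ})\big)=\eta_{ij}$; - adjacent-categories: $\log(\pi_{ij}/\pi_{i,j+1})=\eta_{ij}$;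 - continuation-ratio: $\log\big(\pi_{ij}/(\pi_{i,j+1}+\cdots+\pi_{iJ})\big)=\eta_{ij}$. The parameter space $\boldsymbol\Theta\subseteq\mathbb R^p$ is the set of all feasible $\boldsymbol\theta$. For cumulative logit models, $\boldsymbol\Theta=\{\boldsymbol\theta\in\mathbb R^p:\mathbf h_j^T(\mathbf x_i)\boldsymbol\beta_j<\mathbf h_{j+1}^T(\mathbf x_i)\boldsymbol\beta_{j+1},\ j=1,\dots,J-2,\ i=1,\dots,m\}$; for the other three models $\boldsymbol\Theta$ is typically $\mathbb R^p$ itself. For $\boldsymbol\theta\in\boldsymbol\Theta$ the model determines the category probabilities $\pi_{ij}=\pi_{ij}(\boldsymbol\theta)$. $\mathcal P$ is the set of all permutations of $\{1,\dots,J\}$; each represents an order of the response categories. Sampling. $n_1,\dots,n_m$ are fixed positive integers (the numbers of subjects assigned to the design points in the original experiment) and $n=\sum_{i=1}^mn_i$. The observations $(X_l,Y_l)$, $l=1,\dots,N$, are i.i.d.: $X_l$ takes value $\mathbf x_i$ with probability $n_i/n$, $i=1,\dots,m$, and given $X_l=\mathbf x_i$, $Y_l$ takes value $j\in\{1,\dots,J\}$ with probability $\pi_{i\sigma_0^{-1}(j)}(\boldsymbol\theta_0)$. The summarized data are the counts $Y_{ij}=\#\{l\le N:X_l=\mathbf x_i,\,Y_l=j\}$, and $N_i=\sum_{j=1}^JY_{ij}$. The log-likelihood with parameters $\boldsymbol\theta$ and order $\sigma$ is $$l(\boldsymbol\theta,\sigma)=\sum_{i=1}^m\sum_{j=1}^JY_{ij}\log\pi_{i\sigma^{-1}(j)}(\boldsymbol\theta)+\sum_{i=1}^m\log(N_i!)-\sum_{i=1}^m\sum_{j=1}^J\log(Y_{ij}!).$$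 Criteria. $\mathrm{AIC}(\boldsymbol\theta,\sigma)=-2l(\boldsymbol\theta,\sigma)+2p$ and $\mathrm{BIC}(\boldsymbol\theta,\sigma)=-2l(\boldsymbol\theta,\sigma)+(\log N)p$. *)

theory Defs
  imports "HOL-Probability.Probability" "Jordan_Normal_Form.Matrix"
begin

unbundle no vec_syntax and no m_inv_syntax

text \<open>
  Indices start at 0 throughout: categories are \<open>0, \<dots>, J - 1\<close> (so \<open>J - 1\<close> is the last, or baseline,
  category), design points are \<open>0, \<dots>, m - 1\<close> and observations are \<open>0, 1, 2, \<dots>\<close>.
\<close>

section \<open>The model\<close>

datatype logit_type = Baseline | Cumulative | Adjacent | Continuation

record logit_model =
  logit :: logit_type
  ncat :: nat                               (* J *)
  ncov :: nat                               (* d *)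
  ndes :: nat                               (* m *)
  pts :: "nat \<Rightarrow> real vec"                  (* x_i *)
  dimh :: "nat \<Rightarrow> nat"                      (* p_j *)
  dimc :: nat                               (* p_c *)
  predh :: "nat \<Rightarrow> real vec \<Rightarrow> real vec"    (* h_j *)
  predc :: "real vec \<Rightarrow> real vec"           (* h_c *)

definition logit_design :: "logit_model \<Rightarrow> bool" where
  "logit_design G \<longleftrightarrow>
     3 \<le> ncat G \<and> 1 \<le> ncov G \<and> 1 \<le> ndes G \<and>
     (\<forall>i<ndes G. pts G i \<in> carrier_vec (ncov G)) \<and> inj_on (pts G) {..<ndes G} \<and>
     (\<forall>j<ncat G - 1. predh G j \<in> carrier_vec (ncov G) \<rightarrow> carrier_vec (dimh G j)) \<and>
     predc G \<in> carrier_vec (ncov G) \<rightarrow> carrier_vec (dimc G)"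

definition offset :: "logit_model \<Rightarrow> nat \<Rightarrow> nat" where
  "offset G j = (\<Sum>k<j. dimh G k)"

definition npar :: "logit_model \<Rightarrow> nat" where
  "npar G = (\<Sum>j<ncat G - 1. dimh G j) + dimc G"

definition beta_part :: "logit_model \<Rightarrow> real vec \<Rightarrow> nat \<Rightarrow> real vec" where
  "beta_part G \<theta> j = vec (dimh G j) (\<lambda>k. \<theta> $ (offset G j + k))"

definition zeta_part :: "logit_model \<Rightarrow> real vec \<Rightarrow> real vec" where
  "zeta_part G \<theta> = vec (dimc G) (\<lambda>k. \<theta> $ (offset G (ncat G - 1) + k))"

text \<open>
  Row \<open>j < J - 1\<close> of \<open>X_i\<close> has \<open>h_j(x_i)\<close> in the columns of \<open>\<beta>_j\<close> and \<open>h_c(x_i)\<close> in the columns of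
  \<open>\<zeta>\<close>; the last row is zero, so that the last linear predictor is 0.
\<close>

definition model_mat :: "logit_model \<Rightarrow> nat \<Rightarrow> real mat" where
  "model_mat G i = mat (ncat G) (npar G) (\<lambda>(j, c).
     if j = ncat G - 1 then 0
     else if offset G j \<le> c \<and> c < offset G (Suc j) then predh G j (pts G i) $ (c - offset G j)
     else if offset G (ncat G - 1) \<le> c then predc G (pts G i) $ (c - offset G (ncat G - 1))
     else 0)"

text \<open>
  The \<open>j\<close>-th logit is the log of the ratio of the total probability of \<open>numer_cats t j\<close> to that of
  \<open>denom_cats t J j\<close>. The first \<open>J - 1\<close> rows of \<open>L\<close> form the numerators, the next \<open>J - 1\<close> rows
  the denominators, and the last row the total \<open>\<Sum>\<^sub>j \<pi>\<^sub>i\<^sub>j\<close>; \<open>C\<^sup>T\<close> takes the differences of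
  logarithms and keeps the log of the total as the last component.
\<close>

definition numer_cats :: "logit_type \<Rightarrow> nat \<Rightarrow> nat set" where
  "numer_cats t j = (if t = Cumulative then {..j} else {j})"

definition denom_cats :: "logit_type \<Rightarrow> nat \<Rightarrow> nat \<Rightarrow> nat set" where
  "denom_cats t J j = (case t of
       Baseline \<Rightarrow> {J - 1}
     | Cumulative \<Rightarrow> {Suc j..<J}
     | Adjacent \<Rightarrow> {Suc j}
     | Continuation \<Rightarrow> {Suc j..<J})"

definition L_mat :: "logit_type \<Rightarrow> nat \<Rightarrow> real mat" where
  "L_mat t J = mat (2 * J - 1) J (\<lambda>(r, c).
     if r < J - 1 then of_bool (c \<in> numer_cats t r)
     else if r < 2 * J - 2 then of_bool (c \<in> denom_cats t J (r - (J - 1)))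
     else 1)"

definition CT_mat :: "nat \<Rightarrow> real mat" where
  "CT_mat J = mat J (2 * J - 1) (\<lambda>(r, c).
     if r = J - 1 then of_bool (c = 2 * J - 2)
     else of_bool (c = r) - of_bool (c = J - 1 + r))"

definition is_cat_prob :: "logit_model \<Rightarrow> nat \<Rightarrow> real vec \<Rightarrow> real vec \<Rightarrow> bool" where
  "is_cat_prob G i \<theta> \<pi> \<longleftrightarrow>
     \<pi> \<in> carrier_vec (ncat G) \<and> (\<forall>j<ncat G. 0 < \<pi> $ j) \<and> (\<Sum>j<ncat G. \<pi> $ j) = 1 \<and>
     CT_mat (ncat G) *\<^sub>v map_vec ln (L_mat (logit G) (ncat G) *\<^sub>v \<pi>) = model_mat G i *\<^sub>v \<theta>"

text \<open>
  The parameter space and the fact that a parameter in it determines the category probabilities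
  are justified by \<open>param_space_iff_feasible\<close> and \<open>ex1_cat_prob\<close> below.
\<close>

definition param_space :: "logit_model \<Rightarrow> real vec set" where
  "param_space G = (if logit G = Cumulative
     then {\<theta> \<in> carrier_vec (npar G). \<forall>i<ndes G. \<forall>j<ncat G - 2.
             predh G j (pts G i) \<bullet> beta_part G \<theta> j
               < predh G (Suc j) (pts G i) \<bullet> beta_part G \<theta> (Suc j)}
     else carrier_vec (npar G))"

definition cat_prob :: "logit_model \<Rightarrow> nat \<Rightarrow> real vec \<Rightarrow> real vec" where
  "cat_prob G i \<theta> = (THE \<pi>. is_cat_prob G i \<theta> \<pi>)"


section \<open>Likelihood and information criteria\<close>

definition counts ::
  "logit_model \<Rightarrow> (nat \<Rightarrow> 'w \<Rightarrow> real vec) \<Rightarrow> (nat \<Rightarrow> 'w \<Rightarrow> nat) \<Rightarrow> nat \<Rightarrow> 'w \<Rightarrow> nat \<Rightarrow> nat \<Rightarrow> nat" where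
  "counts G X Y N \<omega> i j = card {l. l < N \<and> X l \<omega> = pts G i \<and> Y l \<omega> = j}"

definition loglik ::
  "logit_model \<Rightarrow> (nat \<Rightarrow> nat \<Rightarrow> nat) \<Rightarrow> real vec \<Rightarrow> (nat \<Rightarrow> nat) \<Rightarrow> real" where
  "loglik G y \<theta> \<sigma> =
     (\<Sum>i<ndes G. \<Sum>j<ncat G. real (y i j) * ln (cat_prob G i \<theta> $ (inv \<sigma> j)))
     + (\<Sum>i<ndes G. ln (fact (\<Sum>j<ncat G. y i j)))
     - (\<Sum>i<ndes G. \<Sum>j<ncat G. ln (fact (y i j)))"

definition is_mle ::
  "logit_model \<Rightarrow> (nat \<Rightarrow> nat \<Rightarrow> nat) \<Rightarrow> real vec \<Rightarrow> (nat \<Rightarrow> nat) \<Rightarrow> bool" where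
  "is_mle G y \<theta> \<sigma> \<longleftrightarrow> \<theta> \<in> param_space G \<and> \<sigma> permutes {..<ncat G} \<and>
     (\<forall>\<theta>' \<sigma>'. \<theta>' \<in> param_space G \<longrightarrow> \<sigma>' permutes {..<ncat G} \<longrightarrow>
        loglik G y \<theta>' \<sigma>' \<le> loglik G y \<theta> \<sigma>)"

definition AIC ::
  "logit_model \<Rightarrow> (nat \<Rightarrow> nat \<Rightarrow> nat) \<Rightarrow> real vec \<Rightarrow> (nat \<Rightarrow> nat) \<Rightarrow> real" where
  "AIC G y \<theta> \<sigma> = - 2 * loglik G y \<theta> \<sigma> + 2 * real (npar G)"

definition BIC ::
  "logit_model \<Rightarrow> nat \<Rightarrow> (nat \<Rightarrow> nat \<Rightarrow> nat) \<Rightarrow> real vec \<Rightarrow> (nat \<Rightarrow> nat) \<Rightarrow> real" where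
  "BIC G N y \<theta> \<sigma> = - 2 * loglik G y \<theta> \<sigma> + ln (real N) * real (npar G)"

section \<open>The unified form and the four logit models\<close>

lemma offset_Suc: "offset G (Suc j) = offset G j + dimh G j"
  by (simp add: offset_def)

lemma offset_mono: "j \<le> k \<Longrightarrow> offset G j \<le> offset G k"
  unfolding offset_def by (rule sum_mono2) auto

lemma npar_offset: "npar G = offset G (ncat G - 1) + dimc G"
  by (simp add: npar_def offset_def)

lemma unified_lhs_index:
  assumes J: "2 \<le> J" and \<pi>: "\<pi> \<in> carrier_vec J" and r: "r < J"
  shows "(CT_mat J *\<^sub>v map_vec ln (L_mat t J *\<^sub>v \<pi>)) $ r =
    (if r = J - 1 then ln (\<Sum>c<J. \<pi> $ c)
     else ln (\<Sum>c<J. of_bool (c \<in> numer_cats t r) * \<pi> $ c)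
        - ln (\<Sum>c<J. of_bool (c \<in> denom_cats t J r) * \<pi> $ c))"
proof -
  have row: "(map_vec ln (L_mat t J *\<^sub>v \<pi>)) $ k =
      ln (\<Sum>c<J. (if k < J - 1 then of_bool (c \<in> numer_cats t k)
        else if k < 2 * J - 2 then of_bool (c \<in> denom_cats t J (k - (J - 1))) else 1) * \<pi> $ c)"
    if "k < 2 * J - 1" for k
    using that \<pi> by (simp add: L_mat_def scalar_prod_def lessThan_atLeast0)
  let ?v = "map_vec ln (L_mat t J *\<^sub>v \<pi>)"
  have dim: "dim_vec ?v = 2 * J - 1" by (simp add: L_mat_def)
  have eq: "(CT_mat J *\<^sub>v ?v) $ r = (\<Sum>k\<in>{0..<2*J-1}.
      (if r = J - 1 then of_bool (k = 2 * J - 2)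
       else of_bool (k = r) - of_bool (k = J - 1 + r)) * ?v $ k)"
    using r dim by (simp add: CT_mat_def scalar_prod_def)
  show ?thesis
  proof (cases "r = J - 1")
    case True
    have "(CT_mat J *\<^sub>v ?v) $ r = (\<Sum>k\<in>{0..<2*J-1}. if k = 2 * J - 2 then ?v $ k else 0)"
      unfolding eq using True by (intro sum.cong) auto
    also have "\<dots> = ?v $ (2 * J - 2)"
      using J by (subst sum.delta) auto
    also have "\<dots> = ln (\<Sum>c<J. \<pi> $ c)"
    proof -
      have "2 * J - 2 < 2 * J - 1" "\<not> 2 * J - 2 < J - 1" using J by auto
      then show ?thesis by (subst row) (simp_all only: if_False mult_1 less_irrefl)
    qed
    finally show ?thesis using True by simp
  next
    case False
    have "(CT_mat J *\<^sub>v ?v) $ r =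
        (\<Sum>k\<in>{0..<2*J-1}. (if k = r then ?v $ k else 0) - (if k = J - 1 + r then ?v $ k else 0))"
      unfolding eq using False by (intro sum.cong) auto
    also have "\<dots> = ?v $ r - ?v $ (J - 1 + r)"
      using J r False unfolding sum_subtractf by (subst (1 2) sum.delta) auto
    also have "?v $ r = ln (\<Sum>c<J. of_bool (c \<in> numer_cats t r) * \<pi> $ c)"
    proof -
      have "r < 2 * J - 1" "r < J - 1" using J r False by auto
      then show ?thesis by (subst row) (simp_all only: if_True)
    qed
    also have "?v $ (J - 1 + r) = ln (\<Sum>c<J. of_bool (c \<in> denom_cats t J r) * \<pi> $ c)"
    proof -
      have "J - 1 + r < 2 * J - 1" "\<not> J - 1 + r < J - 1" "J - 1 + r < 2 * J - 2"
        using J r False by auto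
      then show ?thesis by (subst row) (simp_all only: if_True if_False add_diff_cancel_left')
    qed
    finally show ?thesis using False by simp
  qed
qed

definition lin_pred :: "logit_model \<Rightarrow> nat \<Rightarrow> real vec \<Rightarrow> nat \<Rightarrow> real" where
  "lin_pred G i \<theta> j =
     predh G j (pts G i) \<bullet> beta_part G \<theta> j + predc G (pts G i) \<bullet> zeta_part G \<theta>"

lemma model_mat_index:
  assumes \<theta>: "\<theta> \<in> carrier_vec (npar G)" and r: "r < ncat G"
  shows "(model_mat G i *\<^sub>v \<theta>) $ r = (if r = ncat G - 1 then 0 else lin_pred G i \<theta> r)"
proof (cases "r = ncat G - 1")
  case True
  then show ?thesis
    using \<theta> r by (simp add: model_mat_def scalar_prod_def)
next
  case False
  define a where "a = offset G r"
  define b where "b = offset G (ncat G - 1)"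
  define f where "f c = (if a \<le> c \<and> c < a + dimh G r then predh G r (pts G i) $ (c - a)
     else if b \<le> c then predc G (pts G i) $ (c - b) else 0) * \<theta> $ c" for c
  have ab: "a + dimh G r \<le> b"
    using offset_mono[of "Suc r" "ncat G - 1" G] r False by (simp add: a_def b_def offset_Suc)
  have np: "npar G = b + dimc G" by (simp add: b_def npar_offset)
  have "(model_mat G i *\<^sub>v \<theta>) $ r = (\<Sum>c\<in>{0..<npar G}. f c)"
    using \<theta> r False
    by (simp add: model_mat_def scalar_prod_def f_def a_def[symmetric] b_def[unfolded One_nat_def, symmetric]
        offset_Suc cong: if_cong)
  also have "{0..<npar G} = {0..<a} \<union> {a..<a + dimh G r} \<union> {a + dimh G r..<b} \<union> {b..<b + dimc G}"
    using ab np by auto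
  also have "(\<Sum>c\<in>\<dots>. f c) = sum f {0..<a} + sum f {a..<a + dimh G r}
      + sum f {a + dimh G r..<b} + sum f {b..<b + dimc G}"
    using ab by (subst sum.union_disjoint; (auto)?)+
  also have "sum f {0..<a} = 0" using ab by (intro sum.neutral) (auto simp: f_def)
  also have "sum f {a + dimh G r..<b} = 0" by (intro sum.neutral) (auto simp: f_def)
  also have "sum f {a..<a + dimh G r} = (\<Sum>k\<in>{0..<dimh G r}. f (k + a))"
    using sum.shift_bounds_nat_ivl[of f 0 a "dimh G r"] by (simp add: add.commute)
  also have "\<dots> = predh G r (pts G i) \<bullet> beta_part G \<theta> r"
    unfolding scalar_prod_def beta_part_def
    by (auto intro!: sum.cong simp: f_def a_def add.commute)
  also have "sum f {b..<b + dimc G} = (\<Sum>k\<in>{0..<dimc G}. f (k + b))"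
    using sum.shift_bounds_nat_ivl[of f 0 b "dimc G"] by (simp add: add.commute)
  also have "\<dots> = predc G (pts G i) \<bullet> zeta_part G \<theta>"
    unfolding scalar_prod_def zeta_part_def
    using ab by (auto intro!: sum.cong simp: f_def b_def[unfolded One_nat_def, symmetric] add.commute)
  finally show ?thesis using False by (simp add: lin_pred_def)
qed

definition logit_ratio :: "logit_type \<Rightarrow> nat \<Rightarrow> (nat \<Rightarrow> real) \<Rightarrow> nat \<Rightarrow> real" where
  "logit_ratio t J q j = (case t of
       Baseline \<Rightarrow> q j / q (J - 1)
     | Cumulative \<Rightarrow> (\<Sum>k\<le>j. q k) / (\<Sum>k=Suc j..<J. q k)
     | Adjacent \<Rightarrow> q j / q (Suc j)
     | Continuation \<Rightarrow> q j / (\<Sum>k=Suc j..<J. q k))"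

lemma is_cat_prob_iff:
  assumes J: "3 \<le> ncat G" and \<theta>: "\<theta> \<in> carrier_vec (npar G)"
  shows "is_cat_prob G i \<theta> \<pi> \<longleftrightarrow>
     \<pi> \<in> carrier_vec (ncat G) \<and> (\<forall>j<ncat G. 0 < \<pi> $ j) \<and> (\<Sum>j<ncat G. \<pi> $ j) = 1 \<and>
     (\<forall>j<ncat G - 1. ln (logit_ratio (logit G) (ncat G) (\<lambda>j. \<pi> $ j) j) = lin_pred G i \<theta> j)"
proof (cases "\<pi> \<in> carrier_vec (ncat G) \<and> (\<forall>j<ncat G. 0 < \<pi> $ j) \<and> (\<Sum>j<ncat G. \<pi> $ j) = 1")
  case True
  define J where "J = ncat G"
  have \<pi>: "\<pi> \<in> carrier_vec J" and pos: "\<And>j. j < J \<Longrightarrow> 0 < \<pi> $ j" and one: "(\<Sum>j<J. \<pi> $ j) = 1"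
    using True by (auto simp: J_def)
  have J3: "3 \<le> J" using J by (simp add: J_def)
  have ofb: "(\<Sum>c<J. of_bool (c \<in> A) * \<pi> $ c) = sum (($) \<pi>) A" if "A \<subseteq> {..<J}" for A
  proof -
    have "(\<Sum>c<J. of_bool (c \<in> A) * \<pi> $ c) = (\<Sum>c\<in>A. of_bool (c \<in> A) * \<pi> $ c)"
      using that by (intro sum.mono_neutral_right) auto
    then show ?thesis by simp
  qed
  have rat: "ln (\<Sum>c<J. of_bool (c \<in> numer_cats t r) * \<pi> $ c)
        - ln (\<Sum>c<J. of_bool (c \<in> denom_cats t J r) * \<pi> $ c) = ln (logit_ratio t J (\<lambda>j. \<pi> $ j) r)"
    if r: "r < J - 1" for r t
  proof -
    have sub: "numer_cats t r \<subseteq> {..<J}" "denom_cats t J r \<subseteq> {..<J}"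
      using r by (auto simp: numer_cats_def denom_cats_def split: logit_type.splits)
    have ne: "numer_cats t r \<noteq> {}" "denom_cats t J r \<noteq> {}"
      using r by (auto simp: numer_cats_def denom_cats_def split: logit_type.splits)
    have p: "0 < sum (($) \<pi>) (numer_cats t r)" "0 < sum (($) \<pi>) (denom_cats t J r)"
      using sub ne pos by (auto intro!: sum_pos intro: finite_subset)
    have "ln (sum (($) \<pi>) (numer_cats t r)) - ln (sum (($) \<pi>) (denom_cats t J r))
       = ln (sum (($) \<pi>) (numer_cats t r) / sum (($) \<pi>) (denom_cats t J r))"
      using p by (simp add: ln_div)
    also have "sum (($) \<pi>) (numer_cats t r) / sum (($) \<pi>) (denom_cats t J r)
       = logit_ratio t J (\<lambda>j. \<pi> $ j) r"
      by (cases t) (simp_all add: numer_cats_def denom_cats_def logit_ratio_def)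
    finally show ?thesis by (simp only: ofb[OF sub(1)] ofb[OF sub(2)])
  qed
  let ?l = "CT_mat J *\<^sub>v map_vec ln (L_mat (logit G) J *\<^sub>v \<pi>)"
  have "(?l = model_mat G i *\<^sub>v \<theta>) \<longleftrightarrow> (\<forall>r<J. ?l $ r = (model_mat G i *\<^sub>v \<theta>) $ r)"
    by (auto simp: vec_eq_iff CT_mat_def model_mat_def J_def)
  also have "\<dots> \<longleftrightarrow> (\<forall>r<J. r \<noteq> J - 1 \<longrightarrow>
       ln (logit_ratio (logit G) J (\<lambda>j. \<pi> $ j) r) = lin_pred G i \<theta> r)"
  proof -
    have "(?l $ r = (model_mat G i *\<^sub>v \<theta>) $ r) \<longleftrightarrow> (r \<noteq> J - 1 \<longrightarrow>
       ln (logit_ratio (logit G) J (\<lambda>j. \<pi> $ j) r) = lin_pred G i \<theta> r)" if "r < J" for r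
    proof (cases "r = J - 1")
      case True
      then show ?thesis
        using unified_lhs_index[OF _ \<pi> that, of "logit G"] model_mat_index[OF \<theta>, of r i] J3 that one
        by (simp add: J_def)
    next
      case False
      then show ?thesis
        using unified_lhs_index[OF _ \<pi> that, of "logit G"] model_mat_index[OF \<theta>, of r i] J3 that
          rat[of r "logit G"]
        by (simp add: J_def)
    qed
    then show ?thesis by blast
  qed
  also have "\<dots> \<longleftrightarrow> (\<forall>r<J - 1. ln (logit_ratio (logit G) J (\<lambda>j. \<pi> $ j) r) = lin_pred G i \<theta> r)"
    using J3 by (metis (no_types, lifting) less_Suc_eq Suc_diff_1 not_less_eq
        less_le_trans zero_less_numeral less_irrefl)
  finally show ?thesis
    using True unfolding is_cat_prob_def J_def by blast
next
  case False
  then show ?thesis unfolding is_cat_prob_def by blast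
qed


subsection \<open>Existence and uniqueness of the category probabilities\<close>

lemma ex1_normalized:
  fixes e :: "nat \<Rightarrow> real"
  assumes e: "\<And>j. j \<le> K \<Longrightarrow> 0 < e j" and last: "e K = 1"
    and iff: "\<And>q. (\<And>j. j \<le> K \<Longrightarrow> 0 < q j) \<Longrightarrow> P q \<longleftrightarrow> (\<forall>j\<le>K. q j = e j * q K)"
  shows "\<exists>!\<pi>. \<pi> \<in> carrier_vec (Suc K) \<and> (\<forall>j<Suc K. 0 < \<pi> $ j) \<and> (\<Sum>j<Suc K. \<pi> $ j) = 1 \<and>
           P (\<lambda>j. \<pi> $ j)"
proof
  define S where "S = (\<Sum>j<Suc K. e j)"
  have S: "0 < S" unfolding S_def using e by (intro sum_pos) auto
  let ?v = "vec (Suc K) (\<lambda>j. e j / S)"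
  have pos: "0 < ?v $ j" if "j \<le> K" for j using that e S by simp
  have "(\<Sum>j<Suc K. ?v $ j) = (\<Sum>j<Suc K. e j / S)"
    by (intro sum.cong) auto
  also have "\<dots> = 1" using S by (simp add: sum_divide_distrib[symmetric] S_def)
  finally have one: "(\<Sum>j<Suc K. ?v $ j) = 1" .
  have "P (\<lambda>j. ?v $ j)" using iff[of "\<lambda>j. ?v $ j"] pos last by auto
  then show "?v \<in> carrier_vec (Suc K) \<and> (\<forall>j<Suc K. 0 < ?v $ j) \<and> (\<Sum>j<Suc K. ?v $ j) = 1 \<and>
      P (\<lambda>j. ?v $ j)"
    using pos one by (auto simp del: index_vec)
  fix \<pi>
  assume A: "\<pi> \<in> carrier_vec (Suc K) \<and> (\<forall>j<Suc K. 0 < \<pi> $ j) \<and> (\<Sum>j<Suc K. \<pi> $ j) = 1 \<and>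
      P (\<lambda>j. \<pi> $ j)"
  then have "0 < \<pi> $ j" if "j \<le> K" for j using that by simp
  from iff[of "\<lambda>j. \<pi> $ j", OF this] A[THEN conjunct2, THEN conjunct2, THEN conjunct2]
  have "\<forall>j\<le>K. \<pi> $ j = e j * \<pi> $ K" by (rule iffD1)
  then have *: "\<pi> $ j = e j * \<pi> $ K" if "j \<le> K" for j
    using that by blast
  have "1 = (\<Sum>j<Suc K. \<pi> $ j)" using A by simp
  also have "\<dots> = (\<Sum>j<Suc K. e j * \<pi> $ K)"
    by (rule sum.cong) (rule refl, rule *, simp)
  also have "\<dots> = S * \<pi> $ K" by (simp add: S_def sum_distrib_right[symmetric])
  finally have K: "\<pi> $ K = 1 / S" using S by (simp add: field_simps)
  show "\<pi> = ?v"
  proof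
    fix j assume "j < dim_vec ?v"
    then show "\<pi> $ j = ?v $ j" using *[of j] K by simp
  qed (use A in auto)
qed

lemma ex1_noncumulative:
  fixes \<eta> :: "nat \<Rightarrow> real"
  assumes t: "t \<noteq> Cumulative"
  shows "\<exists>!\<pi>. \<pi> \<in> carrier_vec (Suc K) \<and> (\<forall>j<Suc K. 0 < \<pi> $ j) \<and> (\<Sum>j<Suc K. \<pi> $ j) = 1 \<and>
           (\<forall>j<K. ln (logit_ratio t (Suc K) (\<lambda>j. \<pi> $ j) j) = \<eta> j)"
proof -
  have ln_iff: "ln (a / b) = c \<longleftrightarrow> a = exp c * b" if "0 < a" "0 < b" for a b c :: real
  proof -
    have "ln (a / b) = c \<longleftrightarrow> a / b = exp c"
      using that by (metis divide_pos_pos exp_ln ln_exp)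
    then show ?thesis using that by (simp add: field_simps)
  qed
  consider "t = Baseline" | "t = Adjacent" | "t = Continuation" using t by (cases t) auto
  then show ?thesis
  proof cases
    case 1
    define e where "e j = (if j < K then exp (\<eta> j) else 1)" for j
    show ?thesis
    proof (rule ex1_normalized[where e = e])
      fix q :: "nat \<Rightarrow> real" assume q: "\<And>j. j \<le> K \<Longrightarrow> 0 < q j"
      have "ln (logit_ratio t (Suc K) q j) = \<eta> j \<longleftrightarrow> q j = e j * q K" if "j < K" for j
        using ln_iff[of "q j" "q K"] q that 1 by (simp add: logit_ratio_def e_def)
      then show "(\<forall>j<K. ln (logit_ratio t (Suc K) q j) = \<eta> j) \<longleftrightarrow> (\<forall>j\<le>K. q j = e j * q K)"
        by (auto simp: le_less e_def)
    qed (auto simp: e_def)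
  next
    case 2
    define e where "e j = exp (\<Sum>k=j..<K. \<eta> k)" for j
    have e_step: "e j = exp (\<eta> j) * e (Suc j)" if "j < K" for j
      using that by (simp add: e_def sum.atLeast_Suc_lessThan exp_add)
    show ?thesis
    proof (rule ex1_normalized[where e = e])
      fix q :: "nat \<Rightarrow> real" assume q: "\<And>j. j \<le> K \<Longrightarrow> 0 < q j"
      have "ln (logit_ratio t (Suc K) q j) = \<eta> j \<longleftrightarrow> q j = exp (\<eta> j) * q (Suc j)" if "j < K" for j
        using ln_iff[of "q j" "q (Suc j)"] q that 2 by (simp add: logit_ratio_def)
      then have "(\<forall>j<K. ln (logit_ratio t (Suc K) q j) = \<eta> j) \<longleftrightarrow>
          (\<forall>j<K. q j = exp (\<eta> j) * q (Suc j))" by blast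
      also have "\<dots> \<longleftrightarrow> (\<forall>j\<le>K. q j = e j * q K)"
      proof (intro iffI allI impI)
        fix j assume A: "\<forall>j<K. q j = exp (\<eta> j) * q (Suc j)" and "j \<le> K"
        from \<open>j \<le> K\<close> show "q j = e j * q K"
        proof (induction j rule: inc_induct)
          case base
          then show ?case by (simp add: e_def)
        next
          case (step j)
          have "q j = exp (\<eta> j) * q (Suc j)" using A step by blast
          then show ?case using step.IH e_step[OF step.hyps(2)] by (metis mult.assoc)
        qed
      next
        fix j assume A: "\<forall>j\<le>K. q j = e j * q K" and "j < K"
        have "q j = e j * q K" "q (Suc j) = e (Suc j) * q K"
          using A \<open>j < K\<close> less_imp_le Suc_leI by blast+
        then show "q j = exp (\<eta> j) * q (Suc j)" using e_step[OF \<open>j < K\<close>] by simp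
      qed
      finally show "(\<forall>j<K. ln (logit_ratio t (Suc K) q j) = \<eta> j) \<longleftrightarrow> (\<forall>j\<le>K. q j = e j * q K)" .
    qed (auto simp: e_def)
  next
    case 3
    define W where "W j = (\<Prod>k=j..<K. 1 + exp (\<eta> k))" for j
    define e where "e j = (if j < K then exp (\<eta> j) * W (Suc j) else 1)" for j
    have W_pos: "0 < W j" for j unfolding W_def by (intro prod_pos) (auto intro: add_pos_pos)
    have W_step: "W j = (1 + exp (\<eta> j)) * W (Suc j)" if "j < K" for j
      using that by (simp add: W_def prod.atLeast_Suc_lessThan)
    have sum_e: "(\<Sum>k=j..<Suc K. e k) = W j" if "j \<le> K" for j
      using that
    proof (induction j rule: inc_induct)
      case base
      then show ?case by (simp add: e_def W_def)
    next
      case (step j)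
      have "(\<Sum>k=j..<Suc K. e k) = e j + (\<Sum>k=Suc j..<Suc K. e k)"
        using step by (simp add: sum.atLeast_Suc_lessThan del: sum.op_ivl_Suc)
      then show ?case using step W_step[of j] by (simp add: e_def algebra_simps del: sum.op_ivl_Suc)
    qed
    have tail: "(\<Sum>k=Suc j..<Suc K. q k) = W (Suc j) * q K"
      if "j < K" "\<And>k. j < k \<Longrightarrow> k \<le> K \<Longrightarrow> q k = e k * q K" for q j
    proof -
      have "(\<Sum>k=Suc j..<Suc K. q k) = (\<Sum>k=Suc j..<Suc K. e k * q K)"
        by (rule sum.cong) (rule refl, rule that(2), simp_all)
      also have "\<dots> = (\<Sum>k=Suc j..<Suc K. e k) * q K" by (simp only: sum_distrib_right)
      finally show ?thesis using sum_e[of "Suc j"] that(1) by (simp del: sum.op_ivl_Suc)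
    qed
    show ?thesis
    proof (rule ex1_normalized[where e = e])
      fix q :: "nat \<Rightarrow> real" assume q: "\<And>j. j \<le> K \<Longrightarrow> 0 < q j"
      have "ln (logit_ratio t (Suc K) q j) = \<eta> j \<longleftrightarrow> q j = exp (\<eta> j) * (\<Sum>k=Suc j..<Suc K. q k)"
        if "j < K" for j
      proof -
        have "0 < (\<Sum>k=Suc j..<Suc K. q k)" using that q by (intro sum_pos) auto
        then show ?thesis
          using ln_iff[of "q j" "\<Sum>k=Suc j..<Suc K. q k"] q that 3
          by (simp add: logit_ratio_def del: sum.op_ivl_Suc)
      qed
      then have "(\<forall>j<K. ln (logit_ratio t (Suc K) q j) = \<eta> j) \<longleftrightarrow>
          (\<forall>j<K. q j = exp (\<eta> j) * (\<Sum>k=Suc j..<Suc K. q k))" by blast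
      also have "\<dots> \<longleftrightarrow> (\<forall>j\<le>K. q j = e j * q K)"
      proof (intro iffI allI impI)
        fix j assume A: "\<forall>j<K. q j = exp (\<eta> j) * (\<Sum>k=Suc j..<Suc K. q k)" and "j \<le> K"
        have "\<forall>k. K - d \<le> k \<longrightarrow> k \<le> K \<longrightarrow> q k = e k * q K" for d
        proof (induction d)
          case 0
          then show ?case by (simp add: e_def)
        next
          case (Suc d)
          show ?case
          proof (intro allI impI)
            fix k assume k: "K - Suc d \<le> k" "k \<le> K"
            show "q k = e k * q K"
            proof (cases "k < K")
              case True
              have "(\<Sum>l=Suc k..<Suc K. q l) = W (Suc k) * q K"
              proof (rule tail[OF True])
                fix l assume "k < l" "l \<le> K"
                then have "K - d \<le> l" using k by simp
                then show "q l = e l * q K" using Suc \<open>l \<le> K\<close> by blast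
              qed
              moreover have "q k = exp (\<eta> k) * (\<Sum>l=Suc k..<Suc K. q l)" using A True by blast
              ultimately show ?thesis using True by (simp add: e_def del: sum.op_ivl_Suc)
            next
              case False
              then show ?thesis using k by (simp add: e_def)
            qed
          qed
        qed
        from this[of K] show "q j = e j * q K" using \<open>j \<le> K\<close> diff_self_eq_0 le0 by metis
      next
        fix j assume A: "\<forall>j\<le>K. q j = e j * q K" and "j < K"
        have "(\<Sum>k=Suc j..<Suc K. q k) = W (Suc j) * q K"
          using tail[OF \<open>j < K\<close>] A by blast
        moreover have "q j = e j * q K" using A \<open>j < K\<close> less_imp_le by blast
        ultimately show "q j = exp (\<eta> j) * (\<Sum>k=Suc j..<Suc K. q k)"
          using \<open>j < K\<close> by (simp add: e_def del: sum.op_ivl_Suc)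
      qed
      finally show "(\<forall>j<K. ln (logit_ratio t (Suc K) q j) = \<eta> j) \<longleftrightarrow> (\<forall>j\<le>K. q j = e j * q K)" .
    qed (use W_pos in \<open>auto simp: e_def\<close>)
  qed
qed

lemma cumulative_iff:
  fixes \<eta> :: "nat \<Rightarrow> real"
  assumes pos: "\<And>j. j \<le> K \<Longrightarrow> 0 < q j" and one: "(\<Sum>j<Suc K. q j) = 1" and j: "j < K"
  shows "ln (logit_ratio Cumulative (Suc K) q j) = \<eta> j \<longleftrightarrow> (\<Sum>k\<le>j. q k) = 1 / (1 + exp (- \<eta> j))"
proof -
  define S where "S = (\<Sum>k\<le>j. q k)"
  define T where "T = (\<Sum>k=Suc j..<Suc K. q k)"
  have S: "0 < S" unfolding S_def using pos j by (intro sum_pos) auto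
  have T: "0 < T" unfolding T_def using pos j by (intro sum_pos) auto
  have "{..<Suc K} = {..j} \<union> {Suc j..<Suc K}" using j by auto
  moreover have "sum q ({..j} \<union> {Suc j..<Suc K}) = S + T"
    unfolding S_def T_def by (rule sum.union_disjoint) auto
  ultimately have ST: "S + T = 1" using one by metis
  have "ln (S / T) = \<eta> j \<longleftrightarrow> S / T = exp (\<eta> j)"
    using S T by (metis divide_pos_pos exp_ln ln_exp)
  also have "\<dots> \<longleftrightarrow> S = exp (\<eta> j) * (1 - S)"
  proof -
    have "T = 1 - S" using ST by simp
    then show ?thesis using T by (simp add: divide_eq_eq)
  qed
  also have "\<dots> \<longleftrightarrow> S * (1 + exp (- \<eta> j)) = 1"
  proof -
    have "S = exp (\<eta> j) * (1 - S) \<longleftrightarrow> exp (- \<eta> j) * S = exp (- \<eta> j) * (exp (\<eta> j) * (1 - S))"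
      by simp
    also have "exp (- \<eta> j) * (exp (\<eta> j) * (1 - S)) = 1 - S"
      by (simp add: exp_minus)
    finally show ?thesis by (auto simp: algebra_simps)
  qed
  also have "\<dots> \<longleftrightarrow> S = 1 / (1 + exp (- \<eta> j))"
  proof -
    have "1 + exp (- \<eta> j) \<noteq> 0" using exp_gt_zero[of "- \<eta> j"] by linarith
    then show ?thesis by (simp add: eq_divide_eq)
  qed
  finally show ?thesis by (simp add: logit_ratio_def S_def T_def del: sum.op_ivl_Suc)
qed

lemma cumulative_feasible_iff:
  fixes \<eta> :: "nat \<Rightarrow> real" and K :: nat
  defines "P \<equiv> \<lambda>\<pi>. \<pi> \<in> carrier_vec (Suc K) \<and> (\<forall>j<Suc K. 0 < \<pi> $ j) \<and> (\<Sum>j<Suc K. \<pi> $ j) = 1 \<and>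
           (\<forall>j<K. ln (logit_ratio Cumulative (Suc K) (\<lambda>j. \<pi> $ j) j) = \<eta> j)"
  shows "(\<exists>\<pi>. P \<pi>) \<longleftrightarrow> (\<forall>j<K - 1. \<eta> j < \<eta> (Suc j))"
    and "(\<exists>\<pi>. P \<pi>) \<Longrightarrow> (\<exists>!\<pi>. P \<pi>)"
proof -
  define F where "F j = (if j < K then 1 / (1 + exp (- \<eta> j)) else 1)" for j
  have F_pos: "0 < F j" for j by (simp add: F_def add_pos_pos)
  have F_less: "F j < F (Suc j) \<longleftrightarrow> \<eta> j < \<eta> (Suc j)" if "j < K - 1" for j
  proof -
    have p: "0 < 1 + exp (- x)" for x :: real by (simp add: add_pos_pos)
    have "F j < F (Suc j) \<longleftrightarrow> 1 / (1 + exp (- \<eta> j)) < 1 / (1 + exp (- \<eta> (Suc j)))"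
    proof -
      have "j < K" "Suc j < K" using that by auto
      then show ?thesis by (simp add: F_def)
    qed
    also have "\<dots> \<longleftrightarrow> 1 + exp (- \<eta> (Suc j)) < 1 + exp (- \<eta> j)"
      using p[of "\<eta> j"] p[of "\<eta> (Suc j)"] by (simp add: divide_less_eq less_divide_eq)
    finally show ?thesis by simp
  qed
  have P_iff: "P \<pi> \<longleftrightarrow> \<pi> \<in> carrier_vec (Suc K) \<and> (\<forall>j\<le>K. 0 < \<pi> $ j) \<and>
      (\<forall>j\<le>K. (\<Sum>k\<le>j. \<pi> $ k) = F j)" for \<pi>
  proof (cases "(\<forall>j\<le>K. 0 < \<pi> $ j) \<and> (\<Sum>j<Suc K. \<pi> $ j) = 1")
    case True
    then have "ln (logit_ratio Cumulative (Suc K) (\<lambda>j. \<pi> $ j) j) = \<eta> j \<longleftrightarrow>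
        (\<Sum>k\<le>j. \<pi> $ k) = F j" if "j < K" for j
      using cumulative_iff[of K "\<lambda>j. \<pi> $ j" j \<eta>] that by (simp add: F_def)
    moreover have "(\<Sum>k\<le>K. \<pi> $ k) = F K" using True by (simp add: F_def lessThan_Suc_atMost)
    ultimately show ?thesis
      using True unfolding P_def by (auto simp: le_less less_Suc_eq_le)
  next
    case False
    then show ?thesis
      unfolding P_def by (auto simp: F_def lessThan_Suc_atMost less_Suc_eq_le)
  qed
  have inc: "\<forall>j<K - 1. \<eta> j < \<eta> (Suc j)" if "P \<pi>" for \<pi>
  proof (intro allI impI)
    fix j assume j: "j < K - 1"
    have "Suc j \<le> K" using j by simp
    then have "F (Suc j) = (\<Sum>k\<le>Suc j. \<pi> $ k)" using that unfolding P_iff by metis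
    also have "\<dots> = F j + \<pi> $ Suc j"
    proof -
      have "(\<Sum>k\<le>j. \<pi> $ k) = F j" using that j by (simp add: P_iff)
      then show ?thesis by simp
    qed
    finally have "F j < F (Suc j)" using that j by (simp add: P_iff)
    then show "\<eta> j < \<eta> (Suc j)" using F_less[OF j] by simp
  qed
  have uniq: "\<pi> = vec (Suc K) (\<lambda>j. case j of 0 \<Rightarrow> F 0 | Suc i \<Rightarrow> F (Suc i) - F i)" (is "_ = ?v")
    if "P \<pi>" for \<pi>
  proof
    fix j assume "j < dim_vec ?v"
    then have j: "j \<le> K" by simp
    show "\<pi> $ j = ?v $ j"
    proof (cases j)
      case 0
      then show ?thesis using that unfolding P_iff by (auto dest: spec[of _ 0])
    next
      case (Suc i)
      then have "Suc i \<le> K" "i \<le> K" using j by auto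
      then have "(\<Sum>k\<le>Suc i. \<pi> $ k) = F (Suc i)" "(\<Sum>k\<le>i. \<pi> $ k) = F i"
        using that unfolding P_iff by metis+
      then show ?thesis using Suc j by simp
    qed
  qed (use that in \<open>auto simp: P_iff\<close>)
  have ex: "P ?v" if mono: "\<forall>j<K - 1. \<eta> j < \<eta> (Suc j)"
  proof -
    have step: "F i < F (Suc i)" if "i < K" for i
    proof (cases "i < K - 1")
      case True
      then show ?thesis using F_less mono by blast
    next
      case False
      then have "Suc i = K" using that by simp
      then show ?thesis by (auto simp: F_def divide_less_eq add_pos_pos)
    qed
    have pos: "0 < ?v $ j" if "j \<le> K" for j
      using that F_pos step by (cases j) auto
    have sum: "(\<Sum>k\<le>j. ?v $ k) = F j" if "j \<le> K" for j
      using that by (induction j) auto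
    show ?thesis unfolding P_iff using pos sum by simp
  qed
  show "(\<exists>\<pi>. P \<pi>) \<longleftrightarrow> (\<forall>j<K - 1. \<eta> j < \<eta> (Suc j))" using inc ex by blast
  show "\<exists>!\<pi>. P \<pi>" if "\<exists>\<pi>. P \<pi>" using that uniq by metis
qed

lemma param_space_carrier: "\<theta> \<in> param_space G \<Longrightarrow> \<theta> \<in> carrier_vec (npar G)"
  by (auto simp: param_space_def split: if_splits)

theorem param_space_iff_feasible:
  assumes J: "3 \<le> ncat G"
  shows "\<theta> \<in> param_space G \<longleftrightarrow>
     \<theta> \<in> carrier_vec (npar G) \<and> (\<forall>i<ndes G. \<exists>\<pi>. is_cat_prob G i \<theta> \<pi>)"
proof (cases "\<theta> \<in> carrier_vec (npar G)")
  case True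
  obtain K where K: "ncat G = Suc K" using J by (cases "ncat G") auto
  show ?thesis
  proof (cases "logit G = Cumulative")
    case C: True
    have "(\<exists>\<pi>. is_cat_prob G i \<theta> \<pi>) \<longleftrightarrow> (\<forall>j<ncat G - 2.
        predh G j (pts G i) \<bullet> beta_part G \<theta> j
          < predh G (Suc j) (pts G i) \<bullet> beta_part G \<theta> (Suc j))" for i
      using cumulative_feasible_iff(1)[of K "lin_pred G i \<theta>"]
      unfolding is_cat_prob_iff[OF J True] C K by (simp add: lin_pred_def numeral_2_eq_2)
    then show ?thesis using True C by (simp add: param_space_def)
  next
    case False
    have "\<exists>\<pi>. is_cat_prob G i \<theta> \<pi>" for i
      using ex1_implies_ex[OF ex1_noncumulative[OF False, of K "lin_pred G i \<theta>"]]
      unfolding is_cat_prob_iff[OF J True] K by simp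
    then show ?thesis using True False by (simp add: param_space_def)
  qed
qed (auto dest: param_space_carrier)

theorem ex1_cat_prob:
  assumes J: "3 \<le> ncat G" and \<theta>: "\<theta> \<in> param_space G" and i: "i < ndes G"
  shows "\<exists>!\<pi>. is_cat_prob G i \<theta> \<pi>"
proof -
  obtain K where K: "ncat G = Suc K" using J by (cases "ncat G") auto
  have carr: "\<theta> \<in> carrier_vec (npar G)" using \<theta> by (rule param_space_carrier)
  show ?thesis
  proof (cases "logit G = Cumulative")
    case True
    have "\<exists>\<pi>. is_cat_prob G i \<theta> \<pi>" using \<theta> i param_space_iff_feasible[OF J] by blast
    then show ?thesis
      using cumulative_feasible_iff(2)[of K "lin_pred G i \<theta>"]
      unfolding is_cat_prob_iff[OF J carr] True K by simp
  next
    case False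
    show ?thesis
      using ex1_noncumulative[OF False, of K "lin_pred G i \<theta>"]
      unfolding is_cat_prob_iff[OF J carr] K by simp
  qed
qed

lemma cat_prob:
  assumes "3 \<le> ncat G" "\<theta> \<in> param_space G" "i < ndes G"
  shows "is_cat_prob G i \<theta> (cat_prob G i \<theta>)"
  unfolding cat_prob_def using ex1_cat_prob[OF assms] by (rule theI')

end

theory Submission
  imports Defs
begin

text \<open>
  The cell frequencies converge almost surely to the cell probabilities by Hoeffding's inequality
  and the Borel-Cantelli lemma. The maximized log-likelihood per observation exceeds the true
  one by a nonnegative amount, and by Gibbs' inequality by at most the Kullback-Leibler divergence of
  the cell frequencies from the true cell probabilities, which tends to 0. Neither compactness of
  the parameter space nor consistency of the estimator is involved.
\<close>

section \<open>Strong law for bounded independent variables, and relative frequencies\<close>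

theorem (in prob_space) strong_law_bounded:
  fixes Z :: "nat \<Rightarrow> 'a \<Rightarrow> real"
  assumes indep: "indep_vars (\<lambda>_. borel) Z UNIV"
    and bounded: "\<And>l. AE \<omega> in M. Z l \<omega> \<in> {a..b}"
    and mean: "\<And>l. expectation (Z l) = \<mu>"
  shows "AE \<omega> in M. (\<lambda>N. (\<Sum>l<N. Z l \<omega>) / real N) \<longlonglongrightarrow> \<mu>"
proof -
  \<comment> \<open>Widening the interval makes its length positive even if \<open>a = b\<close>.
    Otherwise the exponent defining \<open>c\<close> below would be a division by zero, with value
    0, giving \<open>c = 1\<close>.\<close>
  define b' where "b' = max b (a + 1)"
  have ab: "a < b'" by (simp add: b'_def)
  have bounded': "AE \<omega> in M. Z l \<omega> \<in> {a..b'}" for l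
    using bounded[of l] by eventually_elim (auto simp: b'_def)
  have [measurable]: "random_variable borel (Z l)" for l
    using indep by (auto simp: indep_vars_def)
  define A where "A \<epsilon> N = {\<omega> \<in> space M. \<epsilon> * real N \<le> \<bar>(\<Sum>l<N. Z l \<omega>) - real N * \<mu>\<bar>}" for \<epsilon> N
  have A_meas [measurable]: "A \<epsilon> N \<in> events" for \<epsilon> N unfolding A_def by measurable
  have dev: "AE \<omega> in M. \<forall>\<^sub>F N in sequentially. \<omega> \<notin> A \<epsilon> N" if \<epsilon>: "0 < \<epsilon>" for \<epsilon>
  proof -
    define c where "c = exp (- 2 * \<epsilon>\<^sup>2 / (b' - a)\<^sup>2)"
    have c: "0 \<le> c" "c < 1" using \<epsilon> ab by (auto simp: c_def)
    \<comment> \<open>All \<open>N\<close> variables share the range \<open>b' - a\<close>, so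
      Hoeffding's exponent is linear in \<open>N\<close> and the bound is a geometric sequence,
      hence summable for Borel-Cantelli. At \<open>N = 0\<close> the event is the whole space, and
      the bound 2 is trivial.\<close>
    have "prob (A \<epsilon> N) \<le> 2 * c ^ N" for N
    proof (cases "N = 0")
      case True
      then show ?thesis by (simp add: order_trans[OF prob_le_1])
    next
      case False
      interpret Hoeffding_ineq M "{..<N}" Z "\<lambda>_. a" "\<lambda>_. b'" "\<Sum>l<N. expectation (Z l)"
        by unfold_locales (use bounded' indep_vars_subset[OF indep] in auto)
      have "prob (A \<epsilon> N) \<le> 2 * exp (- 2 * (\<epsilon> * real N)\<^sup>2 / (real N * (b' - a)\<^sup>2))"
        using Hoeffding_ineq_abs_ge[of "\<epsilon> * real N"] \<epsilon> ab False by (simp add: A_def mean)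
      also have "- 2 * (\<epsilon> * real N)\<^sup>2 / (real N * (b' - a)\<^sup>2) = real N * (- 2 * \<epsilon>\<^sup>2 / (b' - a)\<^sup>2)"
        using False by (simp add: power2_eq_square)
      also have "exp \<dots> = c ^ N" unfolding c_def by (rule exp_of_nat_mult)
      finally show ?thesis .
    qed
    moreover have "summable (\<lambda>N. 2 * c ^ N)"
      using c by (intro summable_mult summable_geometric) simp
    ultimately have "summable (\<lambda>N. prob (A \<epsilon> N))"
      using summable_comparison_test'[of "\<lambda>N. 2 * c ^ N" 0 "\<lambda>N. prob (A \<epsilon> N)"] by simp
    then have "AE \<omega> in M. \<forall>\<^sub>F N in sequentially. \<omega> \<in> space M - A \<epsilon> N"
      by (intro borel_cantelli_AE1) (auto simp: less_top[symmetric])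
    then show ?thesis by (rule AE_mp) (auto elim: eventually_mono)
  qed
  \<comment> \<open>The exceptional null set depends on the tolerance; restricting to the countably
    many tolerances \<open>1 / real (Suc k)\<close> leaves a single null set.\<close>
  have "AE \<omega> in M. \<forall>k. \<forall>\<^sub>F N in sequentially. \<omega> \<notin> A (1 / real (Suc k)) N"
    unfolding AE_all_countable using dev by simp
  with AE_space show ?thesis
  proof eventually_elim
    case (elim \<omega>)
    show ?case
    proof (rule tendstoI)
      fix e :: real assume "0 < e"
      then obtain k where k: "1 / real (Suc k) < e" using nat_approx_posE by blast
      have "\<forall>\<^sub>F N in sequentially. \<omega> \<notin> A (1 / real (Suc k)) N" using elim by blast
      with eventually_gt_at_top[of 0]
      show "\<forall>\<^sub>F N in sequentially. dist ((\<Sum>l<N. Z l \<omega>) / real N) \<mu> < e"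
      proof eventually_elim
        case (elim N)
        have "dist ((\<Sum>l<N. Z l \<omega>) / real N) \<mu> = \<bar>(\<Sum>l<N. Z l \<omega>) - real N * \<mu>\<bar> / real N"
        proof -
          have "(\<Sum>l<N. Z l \<omega>) / real N - \<mu> = ((\<Sum>l<N. Z l \<omega>) - real N * \<mu>) / real N"
            using elim(1) by (simp add: field_simps)
          then show ?thesis by (simp add: dist_real_def)
        qed
        also have "\<dots> < 1 / real (Suc k)"
        proof -
          have "\<bar>(\<Sum>l<N. Z l \<omega>) - real N * \<mu>\<bar> < 1 / real (Suc k) * real N"
            using elim(2) \<open>\<omega> \<in> space M\<close> by (simp add: A_def not_le)
          then show ?thesis using elim(1) by (subst pos_divide_less_eq) auto
        qed
        finally show ?case using k by simp
      qed
    qed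
  qed
qed

text \<open>The hits of \<open>A\<close> are counted by the indicators of
  \<open>Z l \<in> A\<close>, which inherit independence from \<open>Z\<close>, lie between 0 and 1
  and have mean \<open>p\<close>.\<close>

corollary (in prob_space) frequency_tendsto_prob:
  assumes indep: "indep_vars (\<lambda>_. N) Z UNIV"
    and A: "A \<in> sets N"
    and law: "\<And>l. \<P>(\<omega> in M. Z l \<omega> \<in> A) = p"
  shows "AE \<omega> in M. (\<lambda>n. real (card {l. l < n \<and> Z l \<omega> \<in> A}) / real n) \<longlonglongrightarrow> p"
proof -
  have meas [measurable]: "Z l \<in> measurable M N" for l
    using indep by (auto simp: indep_vars_def)
  note A [measurable]
  have "expectation (\<lambda>\<omega>. indicator A (Z l \<omega>)) = p" for l
  proof -
    have "expectation (\<lambda>\<omega>. indicator A (Z l \<omega>)) =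
        expectation (indicator {\<omega> \<in> space M. Z l \<omega> \<in> A} :: 'a \<Rightarrow> real)"
      by (intro Bochner_Integration.integral_cong) (auto split: split_indicator)
    also have "\<dots> = prob {\<omega> \<in> space M. Z l \<omega> \<in> A}" by simp
    also have "\<dots> = p" by (rule law)
    finally show ?thesis .
  qed
  then have "AE \<omega> in M. (\<lambda>n. (\<Sum>l<n. indicator A (Z l \<omega>)) / real n) \<longlonglongrightarrow> p"
    by (intro strong_law_bounded[where a = 0 and b = 1] indep_vars_compose2[OF indep])
       (auto split: split_indicator)
  moreover have "(\<Sum>l<n. indicator A (Z l \<omega>)) = real (card {l. l < n \<and> Z l \<omega> \<in> A})" for n \<omega>
  proof -
    have "(\<Sum>l<n. indicator A (Z l \<omega>)) = (\<Sum>l<n. of_bool (Z l \<omega> \<in> A) :: real)"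
      by (simp add: indicator_def)
    also have "\<dots> = real (card ({..<n} \<inter> {l. Z l \<omega> \<in> A}))"
      by (subst sum_of_bool_eq) auto
    also have "{..<n} \<inter> {l. Z l \<omega> \<in> A} = {l. l < n \<and> Z l \<omega> \<in> A}" by auto
    finally show ?thesis .
  qed
  ultimately show ?thesis by simp
qed

section \<open>Gibbs' inequality and the divergence of frequencies\<close>

text \<open>This is \<open>ln x \<le> x - 1\<close> at \<open>x = r c / f c\<close>, weighted by
  \<open>f c\<close> and summed; \<open>p\<close> is only a common reference on both sides. The
  difference of total masses corrects for \<open>f\<close> and \<open>r\<close> not being
  normalized; for equal masses this is the usual Gibbs inequality.\<close>

lemma gibbs_inequality_excess:
  fixes f p r :: "'a \<Rightarrow> real"
  assumes pos: "\<And>c. c \<in> A \<Longrightarrow> 0 < f c" "\<And>c. c \<in> A \<Longrightarrow> 0 < p c" "\<And>c. c \<in> A \<Longrightarrow> 0 < r c"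
  shows "(\<Sum>c\<in>A. f c * ln (r c / p c)) \<le> (\<Sum>c\<in>A. f c * ln (f c / p c)) + ((\<Sum>c\<in>A. r c) - (\<Sum>c\<in>A. f c))"
proof -
  have "f c * ln (r c / p c) \<le> f c * ln (f c / p c) + (r c - f c)" if c: "c \<in> A" for c
  proof -
    have "f c * ln (r c / f c) \<le> f c * (r c / f c - 1)"
      using pos[OF c] by (intro mult_left_mono ln_le_minus_one) auto
    also have "\<dots> = r c - f c" using pos[OF c] by (simp add: algebra_simps)
    finally show ?thesis using pos[OF c] by (simp add: ln_div algebra_simps)
  qed
  then have "(\<Sum>c\<in>A. f c * ln (r c / p c)) \<le> (\<Sum>c\<in>A. f c * ln (f c / p c) + (r c - f c))"
    by (rule sum_mono)
  then show ?thesis by (simp add: sum.distrib sum_subtractf)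
qed

text \<open>Each term is continuous in \<open>f N c\<close> at the positive value
  \<open>p c\<close>, where the logarithm is \<open>ln 1\<close>; the mass correction vanishes there
  as well.\<close>

lemma kl_frequencies_tendsto_0:
  fixes f :: "nat \<Rightarrow> 'a \<Rightarrow> real" and p :: "'a \<Rightarrow> real"
  assumes lim: "\<And>c. c \<in> A \<Longrightarrow> (\<lambda>N. f N c) \<longlonglongrightarrow> p c" and pos: "\<And>c. c \<in> A \<Longrightarrow> 0 < p c"
  shows "(\<lambda>N. (\<Sum>c\<in>A. f N c * ln (f N c / p c)) + ((\<Sum>c\<in>A. p c) - (\<Sum>c\<in>A. f N c))) \<longlonglongrightarrow> 0"
proof -
  have "(\<lambda>N. (\<Sum>c\<in>A. f N c * ln (f N c / p c)) + ((\<Sum>c\<in>A. p c) - (\<Sum>c\<in>A. f N c)))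
      \<longlonglongrightarrow> (\<Sum>c\<in>A. p c * ln (p c / p c)) + ((\<Sum>c\<in>A. p c) - (\<Sum>c\<in>A. p c))"
    by (intro tendsto_intros lim) (auto simp: less_imp_neq[OF pos, symmetric])
  also have "(\<Sum>c\<in>A. p c * ln (p c / p c)) = 0"
    by (intro sum.neutral) (simp add: less_imp_neq[OF pos, symmetric])
  finally show ?thesis by simp
qed

section \<open>Cell probabilities and log-likelihood differences\<close>

text \<open>Conditional on the design point: the joint probability of a cell carries an additional
  design weight \<open>w i\<close>.\<close>

definition cell_prob :: "logit_model \<Rightarrow> real vec \<Rightarrow> (nat \<Rightarrow> nat) \<Rightarrow> nat \<Rightarrow> nat \<Rightarrow> real" where
  "cell_prob G \<theta> \<sigma> i j = cat_prob G i \<theta> $ (inv \<sigma> j)"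

lemma cell_prob_pos:
  assumes "3 \<le> ncat G" "\<theta> \<in> param_space G" "\<sigma> permutes {..<ncat G}" "i < ndes G" "j < ncat G"
  shows "0 < cell_prob G \<theta> \<sigma> i j"
  using cat_prob[OF assms(1,2,4)] permutes_in_image[OF permutes_inv[OF assms(3)], of j] assms(5)
  by (simp add: cell_prob_def is_cat_prob_def)

lemma sum_cell_prob:
  assumes "3 \<le> ncat G" "\<theta> \<in> param_space G" "\<sigma> permutes {..<ncat G}" "i < ndes G"
  shows "(\<Sum>j<ncat G. cell_prob G \<theta> \<sigma> i j) = 1"
proof -
  have "(\<Sum>j<ncat G. cell_prob G \<theta> \<sigma> i j) = (\<Sum>j<ncat G. cat_prob G i \<theta> $ j)"
    using sum.permute[OF permutes_inv[OF assms(3)], of "\<lambda>j. cat_prob G i \<theta> $ j"]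
    by (simp add: cell_prob_def comp_def)
  also have "\<dots> = 1" using cat_prob[OF assms(1,2,4)] by (simp add: is_cat_prob_def)
  finally show ?thesis .
qed

text \<open>The factorial terms depend on the data alone and cancel. The double sum is flattened to
  one sum over cells, the form in which Gibbs' inequality applies.\<close>

lemma loglik_diff:
  assumes "3 \<le> ncat G" "\<theta> \<in> param_space G" "\<sigma> permutes {..<ncat G}"
    "\<theta>' \<in> param_space G" "\<sigma>' permutes {..<ncat G}"
  shows "loglik G y \<theta> \<sigma> - loglik G y \<theta>' \<sigma>' =
    (\<Sum>(i, j)\<in>{..<ndes G} \<times> {..<ncat G}.
       real (y i j) * ln (cell_prob G \<theta> \<sigma> i j / cell_prob G \<theta>' \<sigma>' i j))"
proof -
  have "loglik G y \<theta> \<sigma> - loglik G y \<theta>' \<sigma>' = (\<Sum>i<ndes G. \<Sum>j<ncat G.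
      real (y i j) * ln (cell_prob G \<theta> \<sigma> i j) - real (y i j) * ln (cell_prob G \<theta>' \<sigma>' i j))"
    by (simp add: loglik_def cell_prob_def sum_subtractf)
  also have "\<dots> = (\<Sum>i<ndes G. \<Sum>j<ncat G.
      real (y i j) * ln (cell_prob G \<theta> \<sigma> i j / cell_prob G \<theta>' \<sigma>' i j))"
    using cell_prob_pos[OF assms(1-3)] cell_prob_pos[OF assms(1,4,5)]
    by (intro sum.cong refl) (simp add: ln_divide_pos right_diff_distrib)
  finally show ?thesis by (simp add: sum.cartesian_product)
qed

text \<open>The bound is free of \<open>\<theta>\<close> and \<open>\<sigma>\<close>, so it may be
  used at a maximizer chosen from the data. It is the divergence of the empirical frequencies
  \<open>f\<close> from the joint cell probabilities \<open>p\<close>, with a mass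
  correction.\<close>

lemma loglik_diff_le_kl:
  fixes w :: "nat \<Rightarrow> real"
  assumes G: "3 \<le> ncat G" and \<theta>: "\<theta> \<in> param_space G" and \<sigma>: "\<sigma> permutes {..<ncat G}"
    and \<theta>': "\<theta>' \<in> param_space G" and \<sigma>': "\<sigma>' permutes {..<ncat G}"
    and w: "\<And>i. i < ndes G \<Longrightarrow> 0 < w i"
    and N: "0 < N" and y: "\<And>i j. i < ndes G \<Longrightarrow> j < ncat G \<Longrightarrow> 0 < y i j"
  defines "C \<equiv> {..<ndes G} \<times> {..<ncat G}"
    and "f \<equiv> \<lambda>(i, j). real (y i j) / real N"
    and "p \<equiv> \<lambda>(i, j). w i * cell_prob G \<theta>' \<sigma>' i j"
  shows "(loglik G y \<theta> \<sigma> - loglik G y \<theta>' \<sigma>') / real N \<le>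
    (\<Sum>c\<in>C. f c * ln (f c / p c)) + ((\<Sum>c\<in>C. p c) - (\<Sum>c\<in>C. f c))"
proof -
  \<comment> \<open>The same weights \<open>w i\<close> enter \<open>r\<close> and \<open>p\<close>,
    so they cancel in \<open>r c / p c\<close> and the likelihood ratio is unchanged.\<close>
  define r where "r = (\<lambda>(i, j). w i * cell_prob G \<theta> \<sigma> i j)"
  have "(loglik G y \<theta> \<sigma> - loglik G y \<theta>' \<sigma>') / real N = (\<Sum>c\<in>C. f c * ln (r c / p c))"
    unfolding loglik_diff[OF G \<theta> \<sigma> \<theta>' \<sigma>'] sum_divide_distrib C_def
    by (intro sum.cong refl) (auto simp: f_def r_def p_def less_imp_neq[OF w, symmetric])
  also have "\<dots> \<le> (\<Sum>c\<in>C. f c * ln (f c / p c)) + ((\<Sum>c\<in>C. r c) - (\<Sum>c\<in>C. f c))"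
    using w N y G \<theta> \<sigma> \<theta>' \<sigma>'
    by (intro gibbs_inequality_excess) (auto simp: C_def f_def p_def r_def cell_prob_pos)
  \<comment> \<open>Cell probabilities at each design point sum to 1 under either parameter, so
    \<open>r\<close> and \<open>p\<close> have the same mass. This removes the last trace of
    \<open>\<theta>\<close> and \<open>\<sigma>\<close> from the bound.\<close>
  also have "(\<Sum>c\<in>C. r c) = (\<Sum>i<ndes G. w i)"
    using sum_cell_prob[OF G \<theta> \<sigma>]
    by (simp add: C_def r_def sum.cartesian_product[symmetric] sum_distrib_left[symmetric])
  also have "\<dots> = (\<Sum>c\<in>C. p c)"
    using sum_cell_prob[OF G \<theta>' \<sigma>']
    by (simp add: C_def p_def sum.cartesian_product[symmetric] sum_distrib_left[symmetric])
  finally show ?thesis .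
qed

section \<open>Differences of the criteria along a sample path\<close>

lemma AIC_diff_eq_BIC_diff:
  "AIC G y \<theta> \<sigma> - AIC G y \<theta>' \<sigma>' = BIC G N y \<theta> \<sigma> - BIC G N y \<theta>' \<sigma>'"
  by (simp add: AIC_def BIC_def)

text \<open>The penalties cancel, and maximality fixes the sign of the log-likelihood difference, so
  an upper bound on that difference suffices.\<close>

lemma AIC_diff_mle:
  assumes "is_mle G y \<theta> \<sigma>" "\<theta>' \<in> param_space G" "\<sigma>' permutes {..<ncat G}"
  shows "\<bar>AIC G y \<theta> \<sigma> - AIC G y \<theta>' \<sigma>'\<bar> = 2 * (loglik G y \<theta> \<sigma> - loglik G y \<theta>' \<sigma>')"
proof -
  have "loglik G y \<theta>' \<sigma>' \<le> loglik G y \<theta> \<sigma>" using assms by (simp add: is_mle_def)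
  then show ?thesis by (simp add: AIC_def)
qed

text \<open>The deterministic core, for one fixed sample path: convergent frequencies and eventual
  maximality are all that is used of the randomness.\<close>

lemma AIC_diff_mle_tendsto_0:
  fixes w :: "nat \<Rightarrow> real" and y :: "nat \<Rightarrow> nat \<Rightarrow> nat \<Rightarrow> nat"
  assumes G: "3 \<le> ncat G" and \<theta>\<^sub>0: "\<theta>\<^sub>0 \<in> param_space G" and \<sigma>\<^sub>0: "\<sigma>\<^sub>0 permutes {..<ncat G}"
    and w: "\<And>i. i < ndes G \<Longrightarrow> 0 < w i"
    and freq: "\<And>i j. i < ndes G \<Longrightarrow> j < ncat G \<Longrightarrow>
      (\<lambda>N. real (y N i j) / real N) \<longlonglongrightarrow> w i * cell_prob G \<theta>\<^sub>0 \<sigma>\<^sub>0 i j"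
    and mle: "\<forall>\<^sub>F N in sequentially. is_mle G (y N) (\<theta> N) (\<sigma> N)"
  shows "(\<lambda>N. 1 / real N * \<bar>AIC G (y N) (\<theta> N) (\<sigma> N) - AIC G (y N) \<theta>\<^sub>0 \<sigma>\<^sub>0\<bar>) \<longlonglongrightarrow> 0"
proof -
  define C where "C = {..<ndes G} \<times> {..<ncat G}"
  define f where "f N = (\<lambda>(i, j). real (y N i j) / real N)" for N
  define p where "p = (\<lambda>(i, j). w i * cell_prob G \<theta>\<^sub>0 \<sigma>\<^sub>0 i j)"
  define d where "d N = (\<Sum>c\<in>C. f N c * ln (f N c / p c)) + ((\<Sum>c\<in>C. p c) - (\<Sum>c\<in>C. f N c))" for N
  have p_pos: "0 < p c" if "c \<in> C" for c
    using that w cell_prob_pos[OF G \<theta>\<^sub>0 \<sigma>\<^sub>0] by (auto simp: p_def C_def)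
  have f_lim: "(\<lambda>N. f N c) \<longlonglongrightarrow> p c" if "c \<in> C" for c
    using that freq by (auto simp: f_def p_def C_def)
  \<comment> \<open>There are finitely many cells and every limit is positive, so eventually all
    counts are positive at once, as the divergence bound requires.\<close>
  have "\<forall>\<^sub>F N in sequentially. \<forall>c\<in>C. 0 < f N c"
    using order_tendstoD(1)[OF f_lim p_pos] by (intro eventually_ball_finite) (auto simp: C_def)
  with mle eventually_gt_at_top[of 0]
  have bound: "\<forall>\<^sub>F N in sequentially.
      1 / real N * \<bar>AIC G (y N) (\<theta> N) (\<sigma> N) - AIC G (y N) \<theta>\<^sub>0 \<sigma>\<^sub>0\<bar> \<le> 2 * d N"
  proof eventually_elim
    case (elim N)
    have y: "0 < y N i j" if "i < ndes G" "j < ncat G" for i j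
      using elim(3) that by (fastforce simp: C_def f_def zero_less_divide_iff)
    have "(loglik G (y N) (\<theta> N) (\<sigma> N) - loglik G (y N) \<theta>\<^sub>0 \<sigma>\<^sub>0) / real N \<le> d N"
      using loglik_diff_le_kl[OF G _ _ \<theta>\<^sub>0 \<sigma>\<^sub>0 w elim(2) y] elim(1)
      by (simp add: is_mle_def d_def C_def f_def p_def)
    then show ?case
      by (simp add: AIC_diff_mle[OF elim(1) \<theta>\<^sub>0 \<sigma>\<^sub>0] diff_divide_distrib)
  qed
  have "(\<lambda>N. 2 * d N) \<longlonglongrightarrow> 0"
    unfolding d_def using tendsto_mult_right_zero[OF kl_frequencies_tendsto_0[OF f_lim p_pos]] .
  then show ?thesis
    by (rule tendsto_sandwich[OF _ bound tendsto_const, rotated]) simp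
qed

section \<open>Almost sure convergence under the sampling scheme\<close>

theorem corollary1:
  fixes G :: logit_model
    and n :: "nat \<Rightarrow> nat"
    and M :: "'w measure"
    and X :: "nat \<Rightarrow> 'w \<Rightarrow> real vec"
    and Y :: "nat \<Rightarrow> 'w \<Rightarrow> nat"
    and \<theta>\<^sub>0 :: "real vec" and \<sigma>\<^sub>0 :: "nat \<Rightarrow> nat"
    and \<theta>_hat :: "nat \<Rightarrow> 'w \<Rightarrow> real vec" and \<sigma>_hat :: "nat \<Rightarrow> 'w \<Rightarrow> nat \<Rightarrow> nat"
  assumes design: "logit_design G"
    and n_pos: "\<And>i. i < ndes G \<Longrightarrow> 0 < n i"
    and true_param: "\<theta>\<^sub>0 \<in> param_space G"
    and true_order: "\<sigma>\<^sub>0 permutes {..<ncat G}"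
    and prob: "prob_space M"
    and indep: "prob_space.indep_vars M
                  (\<lambda>_. count_space (pts G ` {..<ndes G} \<times> {..<ncat G}))
                  (\<lambda>l \<omega>. (X l \<omega>, Y l \<omega>)) UNIV"
    and law_X: "\<And>l i. i < ndes G \<Longrightarrow>
                  \<P>(\<omega> in M. X l \<omega> = pts G i) = real (n i) / real (\<Sum>k<ndes G. n k)"
    and law_Y: "\<And>l i j. i < ndes G \<Longrightarrow> j < ncat G \<Longrightarrow>
                  \<P>(\<omega> in M. Y l \<omega> = j \<bar> X l \<omega> = pts G i) = cat_prob G i \<theta>\<^sub>0 $ (inv \<sigma>\<^sub>0 j)"
    and mle: "AE \<omega> in M. \<forall>\<^sub>F N in sequentially.
                is_mle G (counts G X Y N \<omega>) (\<theta>_hat N \<omega>) (\<sigma>_hat N \<omega>)"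
  shows "(\<forall>N \<omega>.
            1 / real N * \<bar>AIC G (counts G X Y N \<omega>) (\<theta>_hat N \<omega>) (\<sigma>_hat N \<omega>)
                          - AIC G (counts G X Y N \<omega>) \<theta>\<^sub>0 \<sigma>\<^sub>0\<bar>
          = 1 / real N * \<bar>BIC G N (counts G X Y N \<omega>) (\<theta>_hat N \<omega>) (\<sigma>_hat N \<omega>)
                          - BIC G N (counts G X Y N \<omega>) \<theta>\<^sub>0 \<sigma>\<^sub>0\<bar>)
       \<and> (AE \<omega> in M.
            (\<lambda>N. 1 / real N * \<bar>AIC G (counts G X Y N \<omega>) (\<theta>_hat N \<omega>) (\<sigma>_hat N \<omega>)
                               - AIC G (counts G X Y N \<omega>) \<theta>\<^sub>0 \<sigma>\<^sub>0\<bar>) \<longlonglongrightarrow> 0)"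
proof (intro conjI allI)
  fix N \<omega>
  show "1 / real N * \<bar>AIC G (counts G X Y N \<omega>) (\<theta>_hat N \<omega>) (\<sigma>_hat N \<omega>)
          - AIC G (counts G X Y N \<omega>) \<theta>\<^sub>0 \<sigma>\<^sub>0\<bar>
      = 1 / real N * \<bar>BIC G N (counts G X Y N \<omega>) (\<theta>_hat N \<omega>) (\<sigma>_hat N \<omega>)
          - BIC G N (counts G X Y N \<omega>) \<theta>\<^sub>0 \<sigma>\<^sub>0\<bar>"
    by (simp only: AIC_diff_eq_BIC_diff[where N = N])
next
  interpret prob_space M by (rule prob)
  have G: "3 \<le> ncat G" using design by (simp add: logit_design_def)
  define w where "w i = real (n i) / real (\<Sum>k<ndes G. n k)" for i
  have w: "0 < w i" if "i < ndes G" for i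
  proof -
    have "n i \<le> (\<Sum>k<ndes G. n k)" using that by (intro member_le_sum) auto
    then have "0 < (\<Sum>k<ndes G. n k)" using n_pos[OF that] by linarith
    then show ?thesis using n_pos[OF that] unfolding w_def 
      by (intro divide_pos_pos) (simp_all only: of_nat_0_less_iff)
  qed
  \<comment> \<open>Joint probability as conditional times marginal; \<open>w i > 0\<close> makes
    the conditional probability a genuine quotient.\<close>
  have cell: "\<P>(\<omega> in M. (X l \<omega>, Y l \<omega>) \<in> {(pts G i, j)}) = w i * cell_prob G \<theta>\<^sub>0 \<sigma>\<^sub>0 i j"
    if "i < ndes G" "j < ncat G" for l i j
    using law_Y[OF that, of l] law_X[OF that(1), of l] w[OF that(1)]
    by (simp add: cond_prob_def w_def[symmetric] cell_prob_def conj_commute divide_eq_eq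
        del: of_nat_sum)
  \<comment> \<open>The count of a cell is the number of observed pairs hitting the singleton
    \<open>{(pts G i, j)}\<close>, a measurable set in the count space.\<close>
  have "AE \<omega> in M. (\<lambda>N. real (counts G X Y N \<omega> i j) / real N) \<longlonglongrightarrow> w i * cell_prob G \<theta>\<^sub>0 \<sigma>\<^sub>0 i j"
    if "i < ndes G" "j < ncat G" for i j
    using frequency_tendsto_prob[OF indep _ cell[OF that]] that by (simp add: counts_def)
  then have "AE \<omega> in M. \<forall>i\<in>{..<ndes G}. \<forall>j\<in>{..<ncat G}.
      (\<lambda>N. real (counts G X Y N \<omega> i j) / real N) \<longlonglongrightarrow> w i * cell_prob G \<theta>\<^sub>0 \<sigma>\<^sub>0 i j"
    by (intro AE_finite_allI) auto
  \<comment> \<open>On the intersection of the two almost sure events each sample path satisfies the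
    hypotheses of the deterministic limit.\<close>
  with mle show "AE \<omega> in M.
      (\<lambda>N. 1 / real N * \<bar>AIC G (counts G X Y N \<omega>) (\<theta>_hat N \<omega>) (\<sigma>_hat N \<omega>)
          - AIC G (counts G X Y N \<omega>) \<theta>\<^sub>0 \<sigma>\<^sub>0\<bar>) \<longlonglongrightarrow> 0"
  proof eventually_elim
    case (elim \<omega>)
    then show ?case by (intro AIC_diff_mle_tendsto_0[OF G true_param true_order w]) auto
  qed
qed

end
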